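(* Let $\lambda:\mathbb{Z}\to\mathbb{C}$ and $w:\mathbb{Z}\to\mathbb{C}\setminus\{0\}$ be such that $$\sum_{n=-\infty}^{\infty}\left|\frac{w_n^2}{(\lambda_n-z_0)(\lambda_{n+1}-z_0)}\right|<\infty$$ for some $z_0\in\mathbb{C}_0^\lambda$, and let $z\in\mathbb{C}_0^\lambda$ be a zero of $F_{\mathcal J}$. Then $$\sum_{n=-\infty}^{\infty}f_n^2(z)=A(z)F_{\mathcal J}'(z),$$ where $A(z)$ is given by $$A(z)=w_{n-1}\mathcal P_n(z)\mathcal P_{n-1}(z)\,\frac{\mathfrak F\left(\left\{\frac{\gamma_k^2}{\lambda_k-z}\right\}_{k=n+1}^{\infty}\right)}{\mathfrak F\left(\left\{\frac{\gamma_k^2}{\lambda_k-z}\right\}_{k=-\infty}^{n-1}\right)},$$ with an arbitrary $n\in\mathbb{Z}$ such that the denominator does not vanish.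
   Context: Sets: $\operatorname{Ran}(\lambda)=\{\lambda_n\mid n\in\mathbb{Z}\}$; $\mathbb{C}_0^\lambda=\mathbb{C}\setminus\overline{\operatorname{Ran}(\lambda)}$. Function $\mathfrak F$: for a complex sequence with $\sum_{k\in\mathbb{Z}}|x_kx_{k+1}|<\infty$, $$\mathfrak F(\{x_k\}_{k=-\infty}^{\infty}):=1+\sum_{m=1}^\infty(-1)^m\sum_{k_1=-\infty}^{\infty}\ \sum_{k_2=k_1+2}^{\infty}\cdots\sum_{k_m=k_{m-1}+2}^{\infty}\ \prod_{j=1}^m x_{k_j}x_{k_j+1}.$$ For one-sided sequences, $\mathfrak F(\{x_k\}_{k=n}^{\infty})$ and $\mathfrak F(\{x_k\}_{k=-\infty}^{n})$ are defined by setting the missing $x_k:=0$. Characteristic function: $\gamma:\mathbb{Z}\to\mathbb{C}$ is any sequence with $\gamma_n\gamma_{n+1}=w_n$ for all $n\in\mathbb{Z}$. If the summability condition holds for one $z_0\in\mathbb{C}_0^\lambda$ it holds for all, and $F_{\mathcal J}(z):=\mathfrak F\left(\left\{\frac{\gamma_n^2}{z-\lambda_n}\right\}_{n=-\infty}^\infty\right)$ for $z\in\mathbb{C}_0^\lambda$; this is analytic on $\mathbb{C}_0^\lambda$ and independent of the choice of $\gamma$. $F_{\mathcal J}'$ is its derivative. Products: for $z\notin\operatorname{Ran}(\lambda)$, $\mathcal P_n(z):=\prod_{k=1}^n\frac{w_{k-1}}{z-\lambda_k}$ if $n\ge0$ and $\mathcal P_n(z):=\prod_{k=n+1}^0\frac{z-\lambda_k}{w_{k-1}}$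 if $n<0$. The sequence $f(z)$: for $z\in\mathbb{C}_0^\lambda$ and $n\in\mathbb{Z}$, $f_n(z):=\mathcal P_n(z)\,\mathfrak F\left(\left\{\frac{\gamma_k^2}{\lambda_k-z}\right\}_{k=n+1}^{\infty}\right)$; $f_n^2(z)$ means $(f_n(z))^2$. *)

theory Defs
  imports "HOL-Analysis.Analysis"
begin

(* gap_sum x m p K is the m-fold nested sum over k_1 in K, k_2 >= k_1 + 2, ..., k_m >= k_(m-1) + 2
   of p * (PROD j=1..m. x k_j * x (k_j + 1)); the summand is accumulated in p. *)
primrec gap_sum :: "(int \<Rightarrow> complex) \<Rightarrow> nat \<Rightarrow> complex \<Rightarrow> int set \<Rightarrow> complex" where
  "gap_sum x 0 p K = p"
| "gap_sum x (Suc m) p K = (\<Sum>\<^sub>\<infinity>k\<in>K. gap_sum x m (p * (x k * x (k + 1))) {k + 2..})"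

(* Meaningful only if (SUM k. |x k * x (k + 1)|) is finite. *)
definition FF :: "(int \<Rightarrow> complex) \<Rightarrow> complex" where
  "FF x = 1 + (\<Sum>m. (- 1) ^ Suc m * gap_sum x (Suc m) 1 UNIV)"

definition FF_from :: "int \<Rightarrow> (int \<Rightarrow> complex) \<Rightarrow> complex" where
  "FF_from n x = FF (\<lambda>k. if n \<le> k then x k else 0)"

definition FF_upto :: "int \<Rightarrow> (int \<Rightarrow> complex) \<Rightarrow> complex" where
  "FF_upto n x = FF (\<lambda>k. if k \<le> n then x k else 0)"

definition C0 :: "(int \<Rightarrow> complex) \<Rightarrow> complex set" where
  "C0 lam = UNIV - closure (range lam)"

(* The argument g is any sequence with g n * g (n + 1) = w n. *)
definition F_J :: "(int \<Rightarrow> complex) \<Rightarrow> (int \<Rightarrow> complex) \<Rightarrow> complex \<Rightarrow> complex" where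
  "F_J lam g z = FF (\<lambda>n. (g n)\<^sup>2 / (z - lam n))"

definition P_seq :: "(int \<Rightarrow> complex) \<Rightarrow> (int \<Rightarrow> complex) \<Rightarrow> int \<Rightarrow> complex \<Rightarrow> complex" where
  "P_seq lam w n z =
    (if n \<ge> 0 then \<Prod>k = 1..n. w (k - 1) / (z - lam k)
     else \<Prod>k = n + 1..0. (z - lam k) / w (k - 1))"

definition f_seq ::
  "(int \<Rightarrow> complex) \<Rightarrow> (int \<Rightarrow> complex) \<Rightarrow> (int \<Rightarrow> complex) \<Rightarrow> int \<Rightarrow> complex \<Rightarrow> complex" where
  "f_seq lam w g n z = P_seq lam w n z * FF_from (n + 1) (\<lambda>k. (g k)\<^sup>2 / (lam k - z))"

end

theory Submission
  imports Defs "HOL-Complex_Analysis.Complex_Analysis"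
begin

text \<open>
  The value \<open>\<FF>(x)\<close> is an absolutely convergent sum over finite sets \<open>S\<close> of integers without two
  consecutive elements, with terms \<open>\<Prod>k\<in>S. b k\<close>, \<open>b k = - x k * x (k + 1)\<close>; think of \<open>k \<in> S\<close> as the
  edge \<open>{k, k + 1}\<close> and of \<open>S\<close> as a matching. For \<open>x k = (\<gamma> k)\<^sup>2 / (lam k - z)\<close>, differentiating a term
  multiplies it by the sum of \<open>1 / (lam v - z)\<close> over the vertices \<open>v\<close> covered by \<open>S\<close>. Summing by
  vertices, and using that the matchings avoiding \<open>v\<close> contribute the product \<open>M v * R (v + 1)\<close> of the
  left value (over \<open>k < v\<close>) and the right value (over \<open>k > v\<close>), one obtains at a zero of \<open>F_J\<close> that
  \<open>F_J'\<close> is the sum of \<open>M v * R (v + 1) / (z - lam v)\<close>. At a zero, the sequences \<open>M n\<close> and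
  \<open>w (n - 1) * P n * P (n - 1) * R (n + 1)\<close> solve the same three-term recurrence with vanishing
  Casoratian, so the second is \<open>A\<close> times the first, and the claimed identity holds term by term.
\<close>

section \<open>Series over finite sets of integers without consecutive elements\<close>

definition gap_sets :: "int set \<Rightarrow> int set set" where
  "gap_sets K = {S. finite S \<and> S \<subseteq> K \<and> (\<forall>k\<in>S. k + 1 \<notin> S)}"

text \<open>For an interval \<open>K\<close> this is a (possibly infinite) continuant; the empty set
  supplies the leading 1 of \<open>FF\<close>.\<close>

definition gap_series :: "(int \<Rightarrow> complex) \<Rightarrow> int set \<Rightarrow> complex" where
  "gap_series b K = (\<Sum>\<^sub>\<infinity>S\<in>gap_sets K. prod b S)"

text \<open>Finitely many sets are among the subsets of their union; the sum over all those subsets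
  factors into the product of \<open>norm (b k) + 1\<close>, which the exponential of the total sum
  bounds.\<close>

lemma prod_abs_summable_on_finite_subsets:
  fixes b :: "'a \<Rightarrow> complex"
  assumes "(\<lambda>k. norm (b k)) summable_on UNIV"
  shows "(\<lambda>S. norm (prod b S)) summable_on Collect finite"
proof (rule nonneg_bdd_above_summable_on)
  show "bdd_above (sum (\<lambda>S. norm (prod b S)) ` {F. F \<subseteq> Collect finite \<and> finite F})"
  proof (rule bdd_aboveI2)
    fix \<F> :: "'a set set"
    assume "\<F> \<in> {F. F \<subseteq> Collect finite \<and> finite F}"
    then have fin: "finite (\<Union>\<F>)" "finite \<F>"
      by auto
    have "(\<Sum>S\<in>\<F>. norm (prod b S)) \<le> (\<Sum>S\<in>Pow (\<Union>\<F>). norm (prod b S))"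
      using fin by (intro sum_mono2) auto
    also have "\<dots> = (\<Prod>k\<in>\<Union>\<F>. norm (b k) + 1)"
      using fin by (subst prod_add) (simp_all add: prod_norm)
    also have "\<dots> \<le> (\<Prod>k\<in>\<Union>\<F>. exp (norm (b k)))"
      by (intro prod_mono) (auto simp: add.commute intro: exp_ge_add_one_self)
    also have "\<dots> = exp (\<Sum>k\<in>\<Union>\<F>. norm (b k))"
      using fin by (simp add: exp_sum)
    also have "\<dots> \<le> exp (\<Sum>\<^sub>\<infinity>k. norm (b k))"
      using fin assms by (simp add: finite_sum_le_infsum)
    finally show "(\<Sum>S\<in>\<F>. norm (prod b S)) \<le> exp (\<Sum>\<^sub>\<infinity>k. norm (b k))" .
  qed
qed auto

lemma gap_series_abs_summable:
  fixes b :: "int \<Rightarrow> complex"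
  assumes "(\<lambda>k. norm (b k)) summable_on UNIV"
  shows "(\<lambda>S. norm (prod b S)) summable_on gap_sets K"
  by (rule summable_on_subset_banach[OF prod_abs_summable_on_finite_subsets[OF assms]])
     (auto simp: gap_sets_def)

lemma gap_series_summable:
  fixes b :: "int \<Rightarrow> complex"
  assumes "(\<lambda>k. norm (b k)) summable_on UNIV" "\<G> \<subseteq> gap_sets K"
  shows "prod b summable_on \<G>"
  using abs_summable_summable[OF gap_series_abs_summable[OF assms(1)]] assms(2)
  by (rule summable_on_subset_banach)

text \<open>A set containing \<open>k\<close> arises by inserting \<open>k\<close> into a set that
  avoids \<open>k\<close> and both its neighbours. Every three-term recurrence below comes from
  this.\<close>

lemma gap_series_delete:
  assumes "(\<lambda>k. norm (b k)) summable_on UNIV" "k \<in> K"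
  shows "gap_series b K = gap_series b (K - {k}) + b k * gap_series b (K - {k - 1, k, k + 1})"
proof -
  let ?A = "{S \<in> gap_sets K. k \<in> S}"
  have eq: "gap_sets K = gap_sets (K - {k}) \<union> ?A"
    by (auto simp: gap_sets_def)
  have "gap_series b K = infsum (prod b) (gap_sets (K - {k})) + infsum (prod b) ?A"
    unfolding gap_series_def
    by (subst eq, rule infsum_Un_disjoint; (rule gap_series_summable[OF assms(1), of _ K])?)
       (auto simp: gap_sets_def)
  also have "infsum (prod b) ?A = (\<Sum>\<^sub>\<infinity>S\<in>gap_sets (K - {k - 1, k, k + 1}). b k * prod b S)"
  proof (rule infsum_reindex_bij_witness[where i = "insert k" and j = "\<lambda>S. S - {k}"])
    fix S assume "S \<in> ?A"
    then show "insert k (S - {k}) = S" "b k * prod b (S - {k}) = prod b S"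
      by (auto simp: gap_sets_def prod.remove)
    show "S - {k} \<in> gap_sets (K - {k - 1, k, k + 1})"
      using \<open>S \<in> ?A\<close> by (force simp: gap_sets_def)
  next
    fix S assume "S \<in> gap_sets (K - {k - 1, k, k + 1})"
    then show "insert k S - {k} = S" "insert k S \<in> ?A"
      using assms(2) by (auto simp: gap_sets_def)
  qed
  finally show ?thesis
    by (simp add: gap_series_def infsum_cmult_right')
qed

text \<open>The separation of \<open>A\<close> and \<open>B\<close> makes the union of two
  admissible sets admissible, so admissible sets of \<open>A \<union> B\<close> are pairs and the
  double series factors.\<close>

lemma gap_series_Un:
  assumes "(\<lambda>k. norm (b k)) summable_on UNIV" "A \<inter> B = {}"
    and sep: "\<And>i j. i \<in> A \<Longrightarrow> j \<in> B \<Longrightarrow> j \<noteq> i + 1 \<and> i \<noteq> j + 1"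
  shows "gap_series b (A \<union> B) = gap_series b A * gap_series b B"
proof -
  let ?h = "\<lambda>S T. prod b S * prod b T"
  have bij: "bij_betw (\<lambda>(S, T). S \<union> T) (gap_sets A \<times> gap_sets B) (gap_sets (A \<union> B))"
    by (rule bij_betw_byWitness[where f' = "\<lambda>S. (S \<inter> A, S \<inter> B)"])
       (use assms(2) sep in \<open>auto simp: gap_sets_def, blast+\<close>)
  have un: "prod b (S \<union> T) = ?h S T" if "S \<in> gap_sets A" "T \<in> gap_sets B" for S T
    using that assms(2) by (intro prod.union_disjoint) (auto simp: gap_sets_def)
  have "gap_series b (A \<union> B) = (\<Sum>\<^sub>\<infinity>(S, T)\<in>gap_sets A \<times> gap_sets B. prod b (S \<union> T))"
    unfolding gap_series_def infsum_reindex_bij_betw[OF bij, symmetric]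
    by (simp add: case_prod_unfold)
  also have "\<dots> = (\<Sum>\<^sub>\<infinity>(S, T)\<in>gap_sets A \<times> gap_sets B. ?h S T)"
    by (rule infsum_cong) (auto simp: un)
  also have "\<dots> = (\<Sum>\<^sub>\<infinity>S\<in>gap_sets A. \<Sum>\<^sub>\<infinity>T\<in>gap_sets B. ?h S T)"
  proof (rule infsum_Sigma'_banach[symmetric])
    have "prod b summable_on gap_sets (A \<union> B)"
      by (rule gap_series_summable[OF assms(1) subset_refl])
    then have "(\<lambda>(S, T). prod b (S \<union> T)) summable_on gap_sets A \<times> gap_sets B"
      unfolding summable_on_reindex_bij_betw[OF bij, symmetric] by (simp add: case_prod_unfold)
    then show "(\<lambda>(S, T). ?h S T) summable_on gap_sets A \<times> gap_sets B"
      by (rule summable_on_cong[THEN iffD1, rotated]) (auto simp: un)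
  qed
  also have "\<dots> = gap_series b A * gap_series b B"
    by (simp add: gap_series_def infsum_cmult_right' infsum_cmult_left')
  finally show ?thesis .
qed

lemma gap_series_restrict:
  "gap_series (\<lambda>k. if k \<in> K then b k else 0) UNIV = gap_series b K"
  unfolding gap_series_def
proof (rule infsum_cong_neutral)
  fix S assume "S \<in> gap_sets UNIV - gap_sets K"
  then show "(\<Prod>k\<in>S. if k \<in> K then b k else 0) = 0"
    by (auto simp: gap_sets_def intro!: prod_zero)
qed (auto simp: gap_sets_def intro!: prod.cong)

text \<open>Far to the left the nonempty sets together contribute less than the 1 of the empty set.
  This supplies an index at which the denominator of \<open>A\<close> does not vanish.\<close>

lemma gap_series_atMost_nonzero:
  assumes "(\<lambda>k. norm (b k)) summable_on UNIV"
  shows "\<exists>n. gap_series b {..n} \<noteq> 0"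
proof -
  let ?N = "\<lambda>S. norm (prod b S)"
  have sm: "?N summable_on gap_sets UNIV"
    by (rule gap_series_abs_summable[OF assms])
  then have "(?N has_sum infsum ?N (gap_sets UNIV)) (gap_sets UNIV)"
    by simp
  then obtain \<F> where \<F>: "finite \<F>" "\<F> \<subseteq> gap_sets UNIV"
    "dist (sum ?N \<F>) (infsum ?N (gap_sets UNIV)) < 1"
    unfolding has_sum_def tendsto_iff eventually_finite_subsets_at_top
    by (metis order_refl zero_less_one)
  have "finite (insert 0 (\<Union>\<F>))"
    using \<F> by (auto simp: gap_sets_def)
  \<comment> \<open>Strictly left of all elements of members of \<open>\<F>\<close>, so no nonempty
    subset of \<open>{..n}\<close> belongs to \<open>\<F>\<close>; inserting 0 keeps
    \<open>Min\<close> defined if the union is empty.\<close>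
  define n where "n = Min (insert 0 (\<Union>\<F>)) - 1"
  have n: "n < k" if "k \<in> S" "S \<in> \<F>" for k S
    using Min_le[OF \<open>finite (insert 0 (\<Union>\<F>))\<close>, of k] that unfolding n_def by fastforce
  let ?G = "gap_sets {..n} - {{}}"
  have disj: "\<F> \<inter> ?G = {}"
    using n by (fastforce simp: gap_sets_def)
  have sG: "?N summable_on ?G"
    by (rule summable_on_subset_banach[OF sm]) (auto simp: gap_sets_def)
  have "sum ?N \<F> + infsum ?N ?G = infsum ?N (\<F> \<union> ?G)"
    using \<F>(1) sG disj by (subst infsum_Un_disjoint) auto
  also have "\<dots> \<le> infsum ?N (gap_sets UNIV)"
  proof (rule infsum_mono_neutral)
    show "?N summable_on \<F> \<union> ?G"
      by (rule summable_on_subset_banach[OF sm]) (use \<F>(2) in \<open>auto simp: gap_sets_def\<close>)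
  qed (use sm \<F>(2) in \<open>auto simp: gap_sets_def\<close>)
  finally have "infsum ?N ?G < 1"
    using \<F>(3) by (simp add: dist_real_def)
  then have less: "norm (infsum (prod b) ?G) < 1"
    using norm_infsum_bound[OF sG] by linarith
  have eq: "gap_sets {..n} = insert {} ?G"
    by (auto simp: gap_sets_def)
  have "gap_series b {..n} = 1 + infsum (prod b) ?G"
    unfolding gap_series_def
    by (subst eq, subst infsum_insert) (auto intro: abs_summable_summable[OF sG])
  then show ?thesis
    using less by (intro exI[of _ n]) (auto simp: add_eq_0_iff2 dest: arg_cong[where f = norm])
qed

section \<open>The function \<open>\<FF>\<close> as such a series\<close>

text \<open>The outermost index is the minimum of the set, and the remaining elements form an
  admissible subset of \<open>{k + 2..}\<close>. Upward closure of \<open>K\<close> keeps this tail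
  inside \<open>K\<close>.\<close>

lemma gap_sum_eq_infsum:
  fixes x :: "int \<Rightarrow> complex"
  defines "a \<equiv> \<lambda>k. x k * x (k + 1)"
  assumes "(\<lambda>k. norm (a k)) summable_on UNIV"
    and "\<And>k. k \<in> K \<Longrightarrow> {k..} \<subseteq> K"
  shows "gap_sum x m p K = p * (\<Sum>\<^sub>\<infinity>S\<in>{S \<in> gap_sets K. card S = m}. prod a S)"
  using assms(3)
proof (induction m arbitrary: p K)
  case 0
  have "{S \<in> gap_sets K. card S = 0} = {{}}"
    by (auto simp: gap_sets_def)
  then show ?case
    by simp
next
  case (Suc m)
  let ?G = "\<lambda>K. {S \<in> gap_sets K. card S = m}" and ?H = "{S \<in> gap_sets K. card S = Suc m}"
  let ?D = "SIGMA k:K. ?G {k + 2..}"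
  have bij: "bij_betw (\<lambda>(k, S). insert k S) ?D ?H"
  proof (rule bij_betw_byWitness[where f' = "\<lambda>S. (Min S, S - {Min S})"])
    show "\<forall>q\<in>?D. (\<lambda>S. (Min S, S - {Min S})) ((\<lambda>(k, S). insert k S) q) = q"
    proof
      fix q assume "q \<in> ?D"
      then obtain k S where q: "q = (k, S)" and *: "k \<in> K" "S \<in> gap_sets {k + 2..}"
        by auto
      then have "Min (insert k S) = k"
        by (intro Min_eqI) (auto simp: gap_sets_def)
      moreover have "k \<notin> S"
        using * by (auto simp: gap_sets_def)
      ultimately show "(\<lambda>S. (Min S, S - {Min S})) ((\<lambda>(k, S). insert k S) q) = q"
        unfolding q by auto
    qed
    show "\<forall>S\<in>?H. (\<lambda>(k, S). insert k S) (Min S, S - {Min S}) = S"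
    proof
      fix S assume "S \<in> ?H"
      then have "Min S \<in> S"
        by (intro Min_in) (auto simp: gap_sets_def)
      then show "(\<lambda>(k, S). insert k S) (Min S, S - {Min S}) = S"
        by auto
    qed
    show "(\<lambda>(k, S). insert k S) ` ?D \<subseteq> ?H"
    proof clarify
      fix k S assume *: "k \<in> K" "S \<in> gap_sets {k + 2..}"
      then have "k \<notin> S" "S \<subseteq> K"
        using Suc.prems[of k] by (force simp: gap_sets_def)+
      then show "insert k S \<in> gap_sets K \<and> card (insert k S) = Suc (card S)"
        using * by (force simp: gap_sets_def)
    qed
    show "(\<lambda>S. (Min S, S - {Min S})) ` ?H \<subseteq> ?D"
    proof (rule image_subsetI)
      fix S assume "S \<in> ?H"
      then have *: "S \<in> gap_sets K" "card S = Suc m"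
        by auto
      then have fin: "finite S" and "Min S \<in> S"
        by (auto simp: gap_sets_def intro!: Min_in)
      moreover have "j \<ge> Min S + 2" if "j \<in> S" "j \<noteq> Min S" for j
      proof -
        have "Min S \<le> j" "Min S + 1 \<noteq> j"
          using that fin \<open>Min S \<in> S\<close> * by (auto simp: gap_sets_def)
        then show ?thesis
          using that by linarith
      qed
      ultimately show "(Min S, S - {Min S}) \<in> ?D"
        using * by (auto simp: gap_sets_def)
    qed
  qed
  have ins: "prod a (insert k S) = a k * prod a S" if "S \<in> ?G {k + 2..}" for k S
    using that by (subst prod.insert) (auto simp: gap_sets_def)
  have "prod a summable_on ?H"
    by (rule gap_series_summable[OF assms(2), where K = K]) auto
  then have "(\<lambda>(k, S). prod a (insert k S)) summable_on ?D"
    unfolding summable_on_reindex_bij_betw[OF bij, symmetric] by (simp add: case_prod_unfold)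
  then have smD: "(\<lambda>(k, S). a k * prod a S) summable_on ?D"
    by (rule summable_on_cong[THEN iffD1, rotated]) (auto simp: ins)
  have "gap_sum x (Suc m) p K = (\<Sum>\<^sub>\<infinity>k\<in>K. p * a k * (\<Sum>\<^sub>\<infinity>S\<in>?G {k + 2..}. prod a S))"
    unfolding gap_sum.simps by (rule infsum_cong, subst Suc.IH) (auto simp: a_def)
  also have "\<dots> = p * (\<Sum>\<^sub>\<infinity>k\<in>K. \<Sum>\<^sub>\<infinity>S\<in>?G {k + 2..}. a k * prod a S)"
    by (simp add: infsum_cmult_right' mult.assoc)
  also have "(\<Sum>\<^sub>\<infinity>k\<in>K. \<Sum>\<^sub>\<infinity>S\<in>?G {k + 2..}. a k * prod a S) = (\<Sum>\<^sub>\<infinity>(k, S)\<in>?D. a k * prod a S)"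
    by (rule infsum_Sigma'_banach[OF smD])
  also have "\<dots> = (\<Sum>\<^sub>\<infinity>(k, S)\<in>?D. prod a (insert k S))"
    by (rule infsum_cong) (auto simp: ins)
  also have "\<dots> = infsum (prod a) ?H"
    unfolding infsum_reindex_bij_betw[OF bij, symmetric] by (simp add: case_prod_unfold)
  finally show ?case .
qed

text \<open>Grouping the absolutely convergent series by cardinality gives the nested sums; the sign
  of each factor of \<open>prod\<close> accounts for \<open>(- 1) ^ m\<close>.\<close>

lemma FF_eq_gap_series:
  assumes "(\<lambda>k. norm (x k * x (k + 1))) summable_on UNIV"
  shows "FF x = gap_series (\<lambda>k. - (x k * x (k + 1))) UNIV"
proof -
  let ?a = "\<lambda>k. x k * x (k + 1)" and ?b = "\<lambda>k. - (x k * x (k + 1))"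
  let ?G = "\<lambda>m. {S \<in> gap_sets UNIV. card S = m}"
  let ?c = "\<lambda>m. (- 1) ^ m * gap_sum x m 1 UNIV"
  have sb: "(\<lambda>k. norm (?b k)) summable_on UNIV"
    using assms by simp
  have bij: "bij_betw snd (SIGMA m:UNIV. ?G m) (gap_sets UNIV)"
    by (rule bij_betw_byWitness[where f' = "\<lambda>S. (card S, S)"]) auto
  have "(prod ?b has_sum gap_series ?b UNIV) (gap_sets UNIV)"
    unfolding gap_series_def
    by (intro has_sum_infsum gap_series_summable[OF sb subset_refl])
  then have *: "((\<lambda>q. prod ?b (snd q)) has_sum gap_series ?b UNIV) (SIGMA m:UNIV. ?G m)"
    by (simp only: has_sum_reindex_bij_betw[OF bij])
  have "(?c has_sum gap_series ?b UNIV) UNIV"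
  proof (rule has_sum_SigmaD[OF *])
    fix m :: nat
    have "(prod ?a has_sum infsum (prod ?a) (?G m)) (?G m)"
      by (intro has_sum_infsum gap_series_summable[OF assms, where K = UNIV]) auto
    then have "((\<lambda>S. (- 1) ^ m * prod ?a S) has_sum (- 1) ^ m * infsum (prod ?a) (?G m)) (?G m)"
      by (rule has_sum_cmult_right)
    also have "?this \<longleftrightarrow> ((\<lambda>S. prod ?b S) has_sum ?c m) (?G m)"
      by (subst gap_sum_eq_infsum[OF assms]) (auto simp: prod_uminus intro!: has_sum_cong)
    finally show "((\<lambda>S. prod ?b (snd (m, S))) has_sum ?c m) (?G m)"
      by simp
  qed
  then have sums: "?c sums gap_series ?b UNIV"
    by (rule has_sum_imp_sums)
  then have "gap_series ?b UNIV = ?c 0 + (\<Sum>m. ?c (Suc m))"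
    using suminf_split_head[of ?c] by (simp add: sums_iff)
  then show ?thesis
    by (simp add: FF_def)
qed

lemma FF_from_eq_gap_series:
  assumes "(\<lambda>k. norm (x k * x (k + 1))) summable_on UNIV"
  shows "FF_from n x = gap_series (\<lambda>k. - (x k * x (k + 1))) {n..}"
proof -
  let ?y = "\<lambda>k. if n \<le> k then x k else 0"
  have *: "?y k * ?y (k + 1) = (if k \<in> {n..} then x k * x (k + 1) else 0)" for k
    by auto
  have "(\<lambda>k. norm (?y k * ?y (k + 1))) summable_on UNIV"
    by (rule Infinite_Sum.abs_summable_on_comparison_test[OF assms]) auto
  then have "FF_from n x = gap_series (\<lambda>k. - (?y k * ?y (k + 1))) UNIV"
    unfolding FF_from_def by (rule FF_eq_gap_series)
  also have "\<dots> = gap_series (\<lambda>k. if k \<in> {n..} then - (x k * x (k + 1)) else 0) UNIV"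
    by (intro arg_cong2[where f = gap_series]) auto
  finally show ?thesis
    by (simp only: gap_series_restrict)
qed

text \<open>The edge \<open>{k, k + 1}\<close> survives the cut only if its upper endpoint does,
  hence the bound \<open>n - 1\<close>; in \<open>FF_from\<close> the lower endpoint decides and the
  bound stays \<open>n\<close>.\<close>

lemma FF_upto_eq_gap_series:
  assumes "(\<lambda>k. norm (x k * x (k + 1))) summable_on UNIV"
  shows "FF_upto n x = gap_series (\<lambda>k. - (x k * x (k + 1))) {..n - 1}"
proof -
  let ?y = "\<lambda>k. if k \<le> n then x k else 0"
  have "(\<lambda>k. norm (?y k * ?y (k + 1))) summable_on UNIV"
    by (rule Infinite_Sum.abs_summable_on_comparison_test[OF assms]) auto
  then have "FF_upto n x = gap_series (\<lambda>k. - (?y k * ?y (k + 1))) UNIV"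
    unfolding FF_upto_def by (rule FF_eq_gap_series)
  also have "\<dots> = gap_series (\<lambda>k. if k \<in> {..n - 1} then - (x k * x (k + 1)) else 0) UNIV"
    by (intro arg_cong2[where f = gap_series]) auto
  finally show ?thesis
    by (simp only: gap_series_restrict)
qed

section \<open>The characteristic function and its derivative\<close>

text \<open>The factor \<open>- x k * x (k + 1)\<close> of the edge \<open>{k, k + 1}\<close>; it
  depends on \<open>\<gamma>\<close> only through \<open>w\<close>.\<close>

definition weight :: "(int \<Rightarrow> complex) \<Rightarrow> (int \<Rightarrow> complex) \<Rightarrow> complex \<Rightarrow> int \<Rightarrow> complex" where
  "weight lam w z k = - ((w k)\<^sup>2 / ((lam k - z) * (lam (k + 1) - z)))"

lemma open_C0: "open (C0 lam)"
  by (simp add: C0_def Compl_eq_Diff_UNIV[symmetric] open_Compl)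

lemma C0_dist:
  assumes "z \<in> C0 lam"
  obtains d where "d > 0" "\<And>k. d \<le> norm (lam k - z)"
proof -
  obtain d where d: "d > 0" "ball z d \<subseteq> C0 lam"
    using assms open_C0 open_contains_ball by blast
  have "lam k \<notin> C0 lam" for k
    using closure_subset[of "range lam"] by (auto simp: C0_def)
  then have "lam k \<notin> ball z d" for k
    using d by blast
  then have "d \<le> norm (lam k - z)" for k
    by (simp add: dist_norm norm_minus_commute not_less)
  then show ?thesis
    using d that by blast
qed

text \<open>Each of the two denominators costs one factor \<open>c\<close>. This serves both to
  change the base point and to find a majorant on a disc.\<close>

lemma norm_weight_le:
  assumes "\<And>k. lam k \<noteq> z0" and c: "\<And>k. norm (lam k - z0) \<le> c * norm (lam k - z)"
  shows "norm (weight lam w z k) \<le> c\<^sup>2 * norm (weight lam w z0 k)"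
proof -
  have pos: "0 < norm (lam k - z0)" for k
    using assms(1) by simp
  then have "0 < c * norm (lam k - z)" for k
    using c order_less_le_trans by blast
  then have nz: "lam k \<noteq> z" and "0 < c" for k
    by (auto simp: zero_less_mult_iff)
  have frac: "X / (A * B) \<le> c\<^sup>2 * (X / (A0 * B0))"
    if "X * (A0 * B0) \<le> X * ((c * A) * (c * B))" "0 < A" "0 < B" "0 < A0" "0 < B0"
    for X A B A0 B0 :: real
    using that by (simp add: field_simps power2_eq_square)
  have *: "norm (w k) ^ 2 * (norm (lam k - z0) * norm (lam (k + 1) - z0))
     \<le> norm (w k) ^ 2 * ((c * norm (lam k - z)) * (c * norm (lam (k + 1) - z)))"
    using c \<open>0 < c\<close> by (intro mult_left_mono mult_mono) auto
  have "norm (w k) ^ 2 / (norm (lam k - z) * norm (lam (k + 1) - z))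
      \<le> c\<^sup>2 * (norm (w k) ^ 2 / (norm (lam k - z0) * norm (lam (k + 1) - z0)))"
    using * nz pos by (intro frac) auto
  then show ?thesis
    by (simp add: weight_def norm_mult norm_divide norm_power)
qed

lemma weight_summable:
  assumes "z0 \<in> C0 lam" "z \<in> C0 lam" "(\<lambda>k. norm (weight lam w z0 k)) summable_on UNIV"
  shows "(\<lambda>k. norm (weight lam w z k)) summable_on UNIV"
proof -
  obtain d0 where d0: "d0 > 0" "\<And>k. d0 \<le> norm (lam k - z0)"
    using C0_dist assms(1) by blast
  obtain d where d: "d > 0" "\<And>k. d \<le> norm (lam k - z)"
    using C0_dist assms(2) by blast
  \<comment> \<open>From the triangle inequality, with \<open>norm (z - z0)\<close> bounded by a
    multiple of \<open>norm (lam k - z)\<close> through the distance \<open>d\<close>.\<close>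
  let ?c = "1 + norm (z - z0) / d"
  have "norm (lam k - z0) \<le> ?c * norm (lam k - z)" for k
  proof -
    have "norm (z - z0) * d \<le> norm (z - z0) * norm (lam k - z)"
      using d by (intro mult_left_mono) auto
    then have "norm (z - z0) \<le> norm (z - z0) / d * norm (lam k - z)"
      using d(1) by (simp add: field_simps)
    moreover have "norm (lam k - z0) \<le> norm (lam k - z) + norm (z - z0)"
      using norm_triangle_ineq[of "lam k - z" "z - z0"] by simp
    ultimately show ?thesis
      by (simp add: algebra_simps)
  qed
  moreover have "lam k \<noteq> z0" for k
    using d0(1) d0(2)[of k] by auto
  ultimately have "norm (weight lam w z k) \<le> ?c\<^sup>2 * norm (weight lam w z0 k)" for k
    by (intro norm_weight_le) auto
  then show ?thesis
    by (intro Infinite_Sum.abs_summable_on_comparison_test'[OF summable_on_cmult_right[OF assms(3)]])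
qed

lemma has_field_derivative_prod_log:
  fixes b :: "complex \<Rightarrow> 'a \<Rightarrow> complex"
  assumes "\<And>k. k \<in> S \<Longrightarrow> ((\<lambda>\<zeta>. b \<zeta> k) has_field_derivative b z k * c k) (at z)"
  shows "((\<lambda>\<zeta>. prod (b \<zeta>) S) has_field_derivative prod (b z) S * sum c S) (at z)"
  using assms
proof (induction S rule: infinite_finite_induct)
  case (insert k S)
  then have "((\<lambda>\<zeta>. b \<zeta> k * prod (b \<zeta>) S) has_field_derivative
      b z k * c k * prod (b z) S + prod (b z) S * sum c S * b z k) (at z)"
    by (intro DERIV_mult) auto
  with insert show ?case
    by (simp add: algebra_simps)
qed auto

lemma weight_has_field_derivative:
  assumes "\<And>k. lam k \<noteq> z"
  shows "((\<lambda>\<zeta>. weight lam w \<zeta> k) has_field_derivative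
    weight lam w z k * (1 / (lam k - z) + 1 / (lam (k + 1) - z))) (at z)"
  unfolding weight_def
  by (rule derivative_eq_intros refl | use assms in force)+
     (use assms[of k] assms[of "k + 1"] in \<open>simp add: divide_simps power2_eq_square algebra_simps\<close>)

text \<open>Termwise differentiation: the finite partial sums converge uniformly on a disc, so their
  derivatives converge to the derivative of the limit.\<close>

lemma gap_series_weight_has_field_derivative:
  assumes "z \<in> C0 lam" and sm: "(\<lambda>k. norm (weight lam w z k)) summable_on UNIV"
  obtains D where
    "((\<lambda>\<zeta>. gap_series (weight lam w \<zeta>) UNIV) has_field_derivative D) (at z)"
    "((\<lambda>S. prod (weight lam w z) S * (\<Sum>k\<in>S. 1 / (lam k - z) + 1 / (lam (k + 1) - z)))
       has_sum D) (gap_sets UNIV)"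
proof -
  obtain d where d: "d > 0" "\<And>k. d \<le> norm (lam k - z)"
    using C0_dist assms(1) by blast
  have ne: "lam k \<noteq> z" for k
    using d(1) d(2)[of k] by auto
  let ?B = "cball z (d / 2)" and ?b = "weight lam w" and ?\<Phi> = "finite_subsets_at_top (gap_sets UNIV)"
  \<comment> \<open>Half the distance \<open>d\<close> is used as radius so that moving from
    \<open>z\<close> to \<open>\<zeta>\<close> at most halves any denominator.\<close>
  have near: "norm (lam k - z) \<le> 2 * norm (lam k - \<zeta>)" if "\<zeta> \<in> ?B" for \<zeta> k
  proof -
    have "norm (\<zeta> - z) \<le> d / 2"
      using that by (simp add: dist_norm norm_minus_commute)
    then show ?thesis
      using norm_triangle_ineq[of "lam k - \<zeta>" "\<zeta> - z"] d(2)[of k] by simp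
  qed
  have ne': "lam k \<noteq> \<zeta>" if "\<zeta> \<in> ?B" for \<zeta> k
    using near[OF that, of k] ne[of k] by auto
  let ?s = "\<lambda>\<zeta> S. \<Sum>k\<in>S. 1 / (lam k - \<zeta>) + 1 / (lam (k + 1) - \<zeta>)"
  have der: "((\<lambda>\<zeta>. \<Sum>S\<in>\<F>. prod (?b \<zeta>) S) has_field_derivative
      (\<Sum>S\<in>\<F>. prod (?b \<zeta>) S * ?s \<zeta> S)) (at \<zeta>)" if "\<zeta> \<in> ?B" for \<F> \<zeta>
    using ne'[OF that]
    by (intro DERIV_sum has_field_derivative_prod_log weight_has_field_derivative) auto
  \<comment> \<open>The factor 4 is \<open>2\<^sup>2\<close>, from two halved denominators; the
    majorant does not involve \<open>\<zeta>\<close>.\<close>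
  have le: "norm (prod (?b \<zeta>) S) \<le> norm (prod (\<lambda>k. 4 * ?b z k) S)" if "\<zeta> \<in> ?B" for \<zeta> S
    using norm_weight_le[of lam z 2 \<zeta> w] ne near[OF that]
    by (auto simp: prod_norm[symmetric] norm_mult intro!: prod_mono)
  have "(\<lambda>k. norm (4 * ?b z k)) summable_on UNIV"
    using summable_on_cmult_right[OF sm, of 4] by (simp add: norm_mult)
  then have ulim: "uniform_limit ?B (\<lambda>\<F> \<zeta>. \<Sum>S\<in>\<F>. prod (?b \<zeta>) S)
      (\<lambda>\<zeta>. gap_series (?b \<zeta>) UNIV) ?\<Phi>"
    unfolding gap_series_def
    by (intro Weierstrass_m_test_general[OF le] gap_series_abs_summable)
  have cont: "continuous_on ?B (\<lambda>\<zeta>. \<Sum>S\<in>\<F>. prod (?b \<zeta>) S)" for \<F>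
    using der by (intro continuous_at_imp_continuous_on) (blast intro: DERIV_isCont)
  obtain g' where g': "\<And>\<zeta>. \<zeta> \<in> ball z (d / 2) \<Longrightarrow>
      ((\<lambda>\<zeta>. gap_series (?b \<zeta>) UNIV) has_field_derivative g' \<zeta>) (at \<zeta>) \<and>
      ((\<lambda>\<F>. \<Sum>S\<in>\<F>. prod (?b \<zeta>) S * ?s \<zeta> S) \<longlongrightarrow> g' \<zeta>) ?\<Phi>"
  proof (rule has_complex_derivative_uniform_limit[OF always_eventually ulim])
    show "\<forall>\<F>. continuous_on ?B (\<lambda>\<zeta>. \<Sum>S\<in>\<F>. prod (?b \<zeta>) S) \<and>
      (\<forall>\<zeta>\<in>ball z (d / 2). ((\<lambda>\<zeta>. \<Sum>S\<in>\<F>. prod (?b \<zeta>) S) has_field_derivative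
        (\<Sum>S\<in>\<F>. prod (?b \<zeta>) S * ?s \<zeta> S)) (at \<zeta>))"
      using cont der by auto
  qed (use d in auto)
  from g'[of z] d(1) that[of "g' z"] show ?thesis
    by (simp add: has_sum_def)
qed

text \<open>A vertex \<open>v\<close> is an endpoint of exactly one edge \<open>{k, k + 1}\<close> with \<open>k \<in> S\<close> if \<open>v - 1 \<in> S\<close> or
  \<open>v \<in> S\<close>, and of none otherwise; the sum over pairs (set, endpoint) is rearranged by vertices.\<close>
lemma gap_series_sum_by_vertices:
  fixes b r :: "int \<Rightarrow> complex"
  assumes sm: "(\<lambda>k. norm (b k)) summable_on UNIV" and r: "\<And>k. norm (r k) \<le> C"
    and D: "((\<lambda>S. prod b S * (\<Sum>k\<in>S. r k + r (k + 1))) has_sum D) (gap_sets UNIV)"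
  shows "((\<lambda>v. r v * (gap_series b UNIV - gap_series b (UNIV - {v - 1, v}))) has_sum D) UNIV"
proof -
  \<comment> \<open>The vertices covered by \<open>S\<close>.\<close>
  define N where "N S = S \<union> (\<lambda>k. k + 1) ` S" for S :: "int set"
  let ?G = "gap_sets UNIV" and ?h = "\<lambda>(S, v). prod b S * r v"
  have C: "0 \<le> C"
    using r[of 0] norm_ge_zero order_trans by blast
  have fin: "finite (N S)" if "S \<in> ?G" for S
    using that by (auto simp: N_def gap_sets_def)
  \<comment> \<open>As \<open>S\<close> has no consecutive elements, \<open>S\<close> and its shift
    are disjoint and no vertex is counted twice.\<close>
  have sumN: "sum f (N S) = (\<Sum>k\<in>S. f k + f (k + 1))" if "S \<in> ?G" for S and f :: "int \<Rightarrow> complex"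
  proof -
    have "sum f (N S) = sum f S + sum f ((\<lambda>k. k + 1) ` S)"
      unfolding N_def using that by (intro sum.union_disjoint) (auto simp: gap_sets_def)
    then show ?thesis
      by (simp add: sum.reindex sum.distrib)
  qed
  have "(\<lambda>q. norm (?h q)) summable_on Sigma ?G N"
  proof (rule summable_on_SigmaI)
    fix S assume S: "S \<in> ?G"
    show "((\<lambda>v. norm (?h (S, v))) has_sum (\<Sum>v\<in>N S. norm (?h (S, v)))) (N S)"
      using fin[OF S] by (rule has_sum_finite)
  next
    \<comment> \<open>Doubling \<open>b\<close> absorbs the number of vertices:
      \<open>card (N S)\<close> is at most \<open>2 * 2 ^ card S\<close>, and the power of 2 goes
      into the product.\<close>
    have "(\<lambda>k. norm (2 * b k)) summable_on UNIV"
      using summable_on_cmult_right[OF sm, of 2] by (simp add: norm_mult)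
    then have "(\<lambda>S. 2 * C * norm (prod (\<lambda>k. 2 * b k) S)) summable_on ?G"
      by (intro summable_on_cmult_right gap_series_abs_summable)
    then show "(\<lambda>S. \<Sum>v\<in>N S. norm (?h (S, v))) summable_on ?G"
    proof (rule summable_on_comparison_test)
      fix S assume S: "S \<in> ?G"
      have "card (N S) \<le> 2 * card S"
        unfolding N_def using card_Un_le[of S "(\<lambda>k. k + 1) ` S"] card_image_le[of S "\<lambda>k. k + 1"] S
        by (auto simp: gap_sets_def)
      also have "\<dots> \<le> 2 * 2 ^ card S"
        using less_exp[of "card S"] by simp
      finally have card: "real (card (N S)) \<le> 2 * 2 ^ card S"
        by (metis of_nat_le_iff of_nat_mult of_nat_numeral of_nat_power)
      have "(\<Sum>v\<in>N S. norm (?h (S, v))) \<le> (\<Sum>v\<in>N S. norm (prod b S) * C)"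
        by (intro sum_mono) (auto simp: norm_mult intro!: mult_left_mono r)
      also have "\<dots> = real (card (N S)) * (norm (prod b S) * C)"
        by simp
      also have "\<dots> \<le> 2 * 2 ^ card S * (norm (prod b S) * C)"
        using card C by (intro mult_right_mono) auto
      also have "\<dots> = 2 * C * norm (prod (\<lambda>k. 2 * b k) S)"
        by (simp add: prod.distrib norm_mult norm_power)
      finally show "(\<Sum>v\<in>N S. norm (?h (S, v))) \<le> 2 * C * norm (prod (\<lambda>k. 2 * b k) S)" .
    qed (auto intro: sum_nonneg)
  qed auto
  then have "?h summable_on Sigma ?G N"
    by (rule abs_summable_summable)
  then obtain E where E: "(?h has_sum E) (Sigma ?G N)"
    by (auto simp: summable_on_def)
  \<comment> \<open>Summing the pairs by sets identifies \<open>E\<close> with \<open>D\<close>;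
    summing them by vertices afterwards gives the claim.\<close>
  have "((\<lambda>S. prod b S * (\<Sum>k\<in>S. r k + r (k + 1))) has_sum E) ?G"
  proof (rule has_sum_SigmaD[OF E])
    fix S assume S: "S \<in> ?G"
    have "((\<lambda>v. ?h (S, v)) has_sum (\<Sum>v\<in>N S. ?h (S, v))) (N S)"
      using fin[OF S] by (rule has_sum_finite)
    then show "((\<lambda>v. ?h (S, v)) has_sum prod b S * (\<Sum>k\<in>S. r k + r (k + 1))) (N S)"
      by (simp add: sum_distrib_left[symmetric] sumN[OF S])
  qed
  then have "E = D"
    using D has_sum_unique by blast
  have bij: "bij_betw prod.swap (SIGMA v:UNIV. {S \<in> ?G. v \<in> N S}) (Sigma ?G N)"
    by (rule bij_betw_byWitness[where f' = prod.swap]) auto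
  have "((\<lambda>q. ?h (prod.swap q)) has_sum D) (SIGMA v:UNIV. {S \<in> ?G. v \<in> N S})"
    using E \<open>E = D\<close> by (simp only: has_sum_reindex_bij_betw[OF bij])
  then show ?thesis
  proof (rule has_sum_SigmaD)
    fix v :: int
    let ?K = "gap_sets (UNIV - {v - 1, v})"
    have "v \<in> N S \<longleftrightarrow> v \<in> S \<or> v - 1 \<in> S" for S
      by (force simp: N_def)
    then have "{S \<in> ?G. v \<in> N S} = ?G - ?K"
      by (auto simp: gap_sets_def)
    moreover have "(prod b has_sum gap_series b UNIV - gap_series b (UNIV - {v - 1, v})) (?G - ?K)"
      unfolding gap_series_def
      by (intro has_sum_Diff has_sum_infsum gap_series_summable[OF sm subset_refl])
         (auto simp: gap_sets_def)
    ultimately show "((\<lambda>S. ?h (prod.swap (v, S))) has_sum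
        r v * (gap_series b UNIV - gap_series b (UNIV - {v - 1, v}))) {S \<in> ?G. v \<in> N S}"
      by (simp add: mult.commute[of _ "r v"] has_sum_cmult_right)
  qed
qed

text \<open>At a zero only the negated series of sets missing \<open>v\<close> remains, which turns
  \<open>lam v - z\<close> into \<open>z - lam v\<close>. Removing \<open>v - 1\<close> and
  \<open>v\<close> leaves two separated half-lines, so that series factors.\<close>

lemma gap_series_weight_has_sum_deriv:
  assumes z: "z \<in> C0 lam" and sm: "(\<lambda>k. norm (weight lam w z k)) summable_on UNIV"
    and zero: "gap_series (weight lam w z) UNIV = 0"
  obtains D where
    "((\<lambda>\<zeta>. gap_series (weight lam w \<zeta>) UNIV) has_field_derivative D) (at z)"
    "((\<lambda>v. gap_series (weight lam w z) {..v - 2} * gap_series (weight lam w z) {v + 1..}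
        / (z - lam v)) has_sum D) UNIV"
proof -
  let ?b = "weight lam w z"
  obtain d where d: "d > 0" "\<And>k. d \<le> norm (lam k - z)"
    using C0_dist z by blast
  obtain D where D:
    "((\<lambda>\<zeta>. gap_series (weight lam w \<zeta>) UNIV) has_field_derivative D) (at z)"
    "((\<lambda>S. prod ?b S * (\<Sum>k\<in>S. 1 / (lam k - z) + 1 / (lam (k + 1) - z)))
       has_sum D) (gap_sets UNIV)"
    using gap_series_weight_has_field_derivative[OF z sm] by blast
  have "norm (1 / (lam k - z)) \<le> 1 / d" for k
    using d(2)[of k] d(1) by (simp add: norm_divide frac_le)
  then have "((\<lambda>v. 1 / (lam v - z) * (0 - gap_series ?b (UNIV - {v - 1, v}))) has_sum D) UNIV"
    using gap_series_sum_by_vertices[OF sm _ D(2)] zero by metis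
  moreover have "gap_series ?b (UNIV - {v - 1, v}) = gap_series ?b {..v - 2} * gap_series ?b {v + 1..}"
    for v
    by (subst gap_series_Un[OF sm, symmetric]) (auto intro!: arg_cong[where f = "gap_series ?b"])
  ultimately have "((\<lambda>v. gap_series ?b {..v - 2} * gap_series ?b {v + 1..} / (z - lam v))
      has_sum D) UNIV"
    by (simp add: minus_divide_right)
  with D(1) that show ?thesis
    by blast
qed

section \<open>Proportionality of the two solutions\<close>

lemma P_seq_step:
  assumes "\<And>n. w n \<noteq> 0" "\<And>n. lam n \<noteq> z"
  shows "P_seq lam w (n + 1) z = P_seq lam w n z * w n / (z - lam (n + 1))"
proof (cases "n \<ge> 0")
  case True
  then have "{1..n + 1} = insert (n + 1) {1..n}"
    by auto
  with True show ?thesis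
    by (simp add: P_seq_def mult.commute)
next
  case False
  then have "{n + 1..0} = insert (n + 1) {n + 2..0}"
    by auto
  \<comment> \<open>For \<open>n = -1\<close> the left side falls under the other branch of
    \<open>P_seq\<close>, but both products are then empty.\<close>
  moreover have "P_seq lam w (n + 1) z = (\<Prod>k = n + 2..0. (z - lam k) / w (k - 1))"
    using False by (auto simp: P_seq_def add.commute)
  ultimately show ?thesis
    using False assms(1)[of n] assms(2)[of "n + 1"] by (simp add: P_seq_def)
qed

text \<open>Nonvanishing of \<open>b\<close> lets the recurrence run downwards as well as
  upwards.\<close>

lemma three_term_recurrence_unique:
  fixes b u :: "int \<Rightarrow> complex"
  assumes "\<And>n. u (n + 2) = u (n + 1) + b n * u n" "\<And>n. b n \<noteq> 0"
    and "u m = 0" "u (m + 1) = 0"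
  shows "u n = 0"
proof -
  have "u n = 0 \<and> u (n + 1) = 0"
  proof (induction n rule: int_induct[where k = m])
    case (step1 i)
    then show ?case
      using assms(1)[of i] by (simp add: add.commute)
  next
    case (step2 i)
    then show ?case
      using assms(1)[of "i - 1"] assms(2)[of "i - 1"] by (simp add: add.commute)
  qed (use assms in auto)
  then show ?thesis ..
qed

section \<open>The sum of squares at a zero of the characteristic function\<close>

theorem proposition12:
  fixes lam w \<gamma> :: "int \<Rightarrow> complex" and z0 z :: complex
  assumes "\<And>n. w n \<noteq> 0"
    and "\<And>n. \<gamma> n * \<gamma> (n + 1) = w n"
    and "z0 \<in> C0 lam"
    and "(\<lambda>n. cmod ((w n)\<^sup>2 / ((lam n - z0) * (lam (n + 1) - z0)))) summable_on UNIV"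
    and "z \<in> C0 lam"
    and "F_J lam \<gamma> z = 0"
  shows "\<exists>A :: complex.
     (\<exists>n. FF_upto (n - 1) (\<lambda>k. (\<gamma> k)\<^sup>2 / (lam k - z)) \<noteq> 0) \<and>
     (\<forall>n. FF_upto (n - 1) (\<lambda>k. (\<gamma> k)\<^sup>2 / (lam k - z)) \<noteq> 0 \<longrightarrow>
        A = w (n - 1) * P_seq lam w n z * P_seq lam w (n - 1) z *
            (FF_from (n + 1) (\<lambda>k. (\<gamma> k)\<^sup>2 / (lam k - z)) /
             FF_upto (n - 1) (\<lambda>k. (\<gamma> k)\<^sup>2 / (lam k - z)))) \<and>
     ((\<lambda>n. (f_seq lam w \<gamma> n z)\<^sup>2) has_sum (A * deriv (F_J lam \<gamma>) z)) UNIV"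
proof -
  let ?x = "\<lambda>k. (\<gamma> k)\<^sup>2 / (lam k - z)"
  define b where "b = weight lam w z"
  define R where "R n = gap_series b {n..}" for n
  \<comment> \<open>With this shift \<open>M n\<close> uses the vertices below \<open>n\<close>, and
    \<open>M n * R (n + 1)\<close> belongs to the matchings avoiding the vertex
    \<open>n\<close>.\<close>
  define M where "M n = gap_series b {..n - 2}" for n
  have sm: "(\<lambda>k. norm (weight lam w \<zeta> k)) summable_on UNIV" if "\<zeta> \<in> C0 lam" for \<zeta>
    by (rule weight_summable[OF assms(3) that]) (use assms(4) in \<open>simp add: weight_def\<close>)
  have smb: "(\<lambda>k. norm (b k)) summable_on UNIV"
    unfolding b_def by (rule sm[OF assms(5)])
  obtain d where d: "d > 0" "\<And>k. d \<le> norm (lam k - z)"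
    using C0_dist assms(5) by blast
  have ne: "lam k \<noteq> z" "z - lam k \<noteq> 0" for k
    using d(1) d(2)[of k] by auto
  have b_nz: "b k \<noteq> 0" for k
    using assms(1)[of k] ne(1)[of k] ne(1)[of "k + 1"] by (simp add: b_def weight_def)

  have F: "F_J lam \<gamma> \<zeta> = gap_series (weight lam w \<zeta>) UNIV" if "\<zeta> \<in> C0 lam" for \<zeta>
  proof -
    let ?y = "\<lambda>k. (\<gamma> k)\<^sup>2 / (\<zeta> - lam k)"
    \<comment> \<open>Both denominators change sign, so \<open>\<zeta> - lam k\<close> and
      \<open>lam k - \<zeta>\<close> give the same edge weights.\<close>
    have y: "?y k * ?y (k + 1) = - weight lam w \<zeta> k" for k
    proof -
      have "(\<zeta> - lam k) * (\<zeta> - lam (k + 1)) = (lam k - \<zeta>) * (lam (k + 1) - \<zeta>)"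
        by (simp add: algebra_simps)
      then show ?thesis
        using assms(2)[of k] by (simp add: weight_def power_mult_distrib[symmetric])
    qed
    have "(\<lambda>k. norm (?y k * ?y (k + 1))) summable_on UNIV"
      unfolding y using sm[OF that] by simp
    then show ?thesis
      unfolding F_J_def by (subst FF_eq_gap_series) (simp_all only: y minus_minus)
  qed
  have x: "?x k * ?x (k + 1) = - b k" for k
    using assms(2)[of k] by (simp add: b_def weight_def power_mult_distrib[symmetric])
  have smx: "(\<lambda>k. norm (?x k * ?x (k + 1))) summable_on UNIV"
    unfolding x using smb by simp
  have FF_from: "FF_from (n + 1) ?x = R (n + 1)" and FF_upto: "FF_upto (n - 1) ?x = M n" for n
    unfolding FF_from_eq_gap_series[OF smx] FF_upto_eq_gap_series[OF smx]
    by (simp_all only: x minus_minus) (simp_all add: R_def M_def)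

  have zero: "gap_series b UNIV = 0"
    using F[OF assms(5)] assms(6) by (simp add: b_def)
  have R_rec: "R n = R (n + 1) + b n * R (n + 2)" for n
  proof -
    have "{n..} - {n} = {n + 1..}" "{n..} - {n - 1, n, n + 1} = {n + 2..}"
      by auto
    then show ?thesis
      using gap_series_delete[OF smb, of n "{n..}"] by (simp add: R_def)
  qed
  have M_rec: "M (n + 2) = M (n + 1) + b n * M n" for n
  proof -
    have "{..n} - {n} = {..n - 1}" "{..n} - {n - 1, n, n + 1} = {..n - 2}"
      by auto
    then show ?thesis
      using gap_series_delete[OF smb, of n "{..n}"] by (simp add: M_def)
  qed
  \<comment> \<open>Deleting one edge from the whole line leaves two half-lines on either side; the
    vanishing total couples \<open>M\<close> with \<open>R\<close>.\<close>
  have MR: "M (n + 1) * R (n + 1) + b n * (M n * R (n + 2)) = 0" for n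
  proof -
    have "UNIV - {n} = {..n - 1} \<union> {n + 1..}" "UNIV - {n - 1, n, n + 1} = {..n - 2} \<union> {n + 2..}"
      by auto
    moreover have "gap_series b ({..n - 1} \<union> {n + 1..}) = M (n + 1) * R (n + 1)"
      unfolding M_def R_def by (subst gap_series_Un[OF smb]) auto
    moreover have "gap_series b ({..n - 2} \<union> {n + 2..}) = M n * R (n + 2)"
      unfolding M_def R_def by (subst gap_series_Un[OF smb]) auto
    ultimately show ?thesis
      using gap_series_delete[OF smb, of n UNIV] zero by simp
  qed

  define P where "P n = P_seq lam w n z" for n
  define c where "c n = w (n - 1) * P n * P (n - 1)" for n
  define U where "U n = c n * R (n + 1)" for n
  have P_step: "P (n + 1) = P n * w n / (z - lam (n + 1))" for n
    unfolding P_def by (rule P_seq_step[OF assms(1) ne(1)])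
  have c_eq: "c n = (P n)\<^sup>2 * (z - lam n)" for n
    using P_step[of "n - 1"] ne(2)[of n] by (simp add: c_def power2_eq_square)
  \<comment> \<open>This factor turns the recurrence of \<open>R\<close>, which expresses lower
    indices by higher ones, into the upward recurrence of \<open>M\<close>.\<close>
  have c_step: "c (n + 1) = - b n * c n" for n
  proof -
    have "c (n + 1) = (P n)\<^sup>2 * (w n)\<^sup>2 / (z - lam (n + 1))"
      using ne(2)[of "n + 1"] by (simp add: c_eq P_step power2_eq_square)
    also have "\<dots> = - b n * c n"
      using ne(1)[of n] ne(2)[of n] ne(1)[of "n + 1"] ne(2)[of "n + 1"]
      by (simp add: b_def weight_def c_eq divide_simps) (simp add: algebra_simps)
    finally show ?thesis .
  qed
  have U_rec: "U (n + 2) = U (n + 1) + b n * U n" for n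
  proof -
    have "U (n + 2) = - c (n + 1) * (b (n + 1) * R (n + 3))"
      using c_step[of "n + 1"] by (simp add: U_def add.assoc)
    also have "b (n + 1) * R (n + 3) = R (n + 1) - R (n + 2)"
      using R_rec[of "n + 1"] by (simp add: add.assoc)
    finally show ?thesis
      using c_step[of n] by (simp add: U_def add.assoc algebra_simps)
  qed
  \<comment> \<open>The Casoratian of \<open>U\<close> and \<open>M\<close> vanishes, by
    \<open>MR\<close>.\<close>
  have UM: "U (n + 1) * M n = U n * M (n + 1)" for n
  proof -
    have "U (n + 1) * M n = - c n * (b n * (M n * R (n + 2)))"
      using c_step[of n] by (simp add: U_def add.assoc)
    also have "b n * (M n * R (n + 2)) = - (M (n + 1) * R (n + 1))"
      using MR[of n] by (simp add: add_eq_0_iff)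
    finally show ?thesis
      by (simp add: U_def mult.commute mult.left_commute)
  qed

  obtain m where "gap_series b {..m} \<noteq> 0"
    using gap_series_atMost_nonzero[OF smb] by blast
  then obtain n0 where n0: "M n0 \<noteq> 0"
    by (metis M_def add_diff_cancel_right')
  define A where "A = U n0 / M n0"
  have UA: "U n = A * M n" for n
  proof -
    \<comment> \<open>The difference solves the common recurrence; it vanishes at \<open>n0\<close>
      by the choice of \<open>A\<close> and at \<open>n0 + 1\<close> by \<open>UM\<close>.\<close>
    have "U n - A * M n = 0"
    proof (rule three_term_recurrence_unique[where b = b and m = n0])
      show "U (n + 2) - A * M (n + 2) = U (n + 1) - A * M (n + 1) + b n * (U n - A * M n)" for n
        by (simp add: U_rec M_rec algebra_simps)
      show "U n0 - A * M n0 = 0" "U (n0 + 1) - A * M (n0 + 1) = 0"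
        using UM[of n0] n0 by (simp_all add: A_def field_simps)
    qed (rule b_nz)
    then show ?thesis
      by simp
  qed

  obtain D where D:
    "((\<lambda>\<zeta>. gap_series (weight lam w \<zeta>) UNIV) has_field_derivative D) (at z)"
    "((\<lambda>v. M v * R (v + 1) / (z - lam v)) has_sum D) UNIV"
    using gap_series_weight_has_sum_deriv[OF assms(5) sm[OF assms(5)]] zero
    unfolding b_def R_def M_def by blast
  \<comment> \<open>The equality \<open>F\<close> is available only on \<open>C0 lam\<close>; its
    openness transfers the derivative.\<close>
  have "(F_J lam \<gamma> has_field_derivative D) (at z)"
    using D(1) open_C0 assms(5) by (rule has_field_derivative_transform_within_open) (simp add: F)
  then have deriv: "deriv (F_J lam \<gamma>) z = D"
    by (rule DERIV_imp_deriv)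
  have "(f_seq lam w \<gamma> n z)\<^sup>2 = A * (M n * R (n + 1) / (z - lam n))" for n
  proof -
    have "(f_seq lam w \<gamma> n z)\<^sup>2 = (P n)\<^sup>2 * (R (n + 1))\<^sup>2"
      unfolding f_seq_def FF_from by (simp add: P_def power_mult_distrib)
    also have "\<dots> = U n * R (n + 1) / (z - lam n)"
      using ne(2)[of n] by (simp add: U_def c_eq power2_eq_square)
    finally show ?thesis
      by (simp add: UA)
  qed
  then have sum: "((\<lambda>n. (f_seq lam w \<gamma> n z)\<^sup>2) has_sum A * deriv (F_J lam \<gamma>) z) UNIV"
    unfolding deriv using has_sum_cmult_right[OF D(2), of A] by simp
  \<comment> \<open>The constant was fixed at \<open>n0\<close>, but \<open>UA\<close> recovers it
    at every index where \<open>M\<close> is nonzero.\<close>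
  have "A = w (n - 1) * P_seq lam w n z * P_seq lam w (n - 1) z * (R (n + 1) / M n)"
    if "M n \<noteq> 0" for n
    using UA[of n] that by (simp add: U_def c_def P_def field_simps)
  then show ?thesis
    unfolding FF_from FF_upto
    by (intro exI[of _ A] conjI exI[of _ n0] allI impI n0 sum)
qed

end
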